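(* Let $k,m,n\in\mathbb{Z}$ and $N=\begin{pmatrix}8k+5&2m+1\\0&8n+5\end{pmatrix}\in UT_2(\mathbb{Z})$. Then there are no four matrices in $UT_2(\mathbb{Z})$ having the Jordan $D(N)$-property. Consequently, there is no upper-triangular Jordan $D(N)$-quadruple.
   Context: $UT_2(\mathbb{Z})$ denotes the ring of upper-triangular $2\times 2$ integer matrices, and $A\circ B=\frac12(AB+BA)$ (computed over $\mathbb{Q}$) is the Jordan product. For $N\in UT_2(\mathbb{Z})$, four matrices $A_1,A_2,A_3,A_4\in UT_2(\mathbb{Z})$ (not necessarily distinct or nonzero) have the Jordan $D(N)$-property if for every $1\le i<j\le 4$ there exists $X_{ij}\in UT_2(\mathbb{Z})$ with $A_i\circ A_j+N=X_{ij}^2$. If moreover the $A_i$ are distinct and nonzero, then $\{A_1,A_2,A_3,A_4\}$ is called an upper-triangular Jordan $D(N)$-quadruple. *)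

theory Defs
  imports "Jordan_Normal_Form.Matrix"
begin

definition UT2Z :: "int mat set" where
  "UT2Z = {A \<in> carrier_mat 2 2. upper_triangular A}"

text \<open>The Jordan product of two integer matrices may have half-integer entries,
  so it is taken after embedding them into the rational matrices.\<close>

definition jordan_product :: "rat mat \<Rightarrow> rat mat \<Rightarrow> rat mat" where
  "jordan_product A B = (1/2) \<cdot>\<^sub>m (A * B + B * A)"

definition jordan_D_property :: "int mat \<Rightarrow> (nat \<Rightarrow> int mat) \<Rightarrow> bool" where
  "jordan_D_property N A \<longleftrightarrow>
     (\<forall>i\<in>{1..4}. A i \<in> UT2Z) \<and>
     (\<forall>i j. 1 \<le> i \<and> i < j \<and> j \<le> 4 \<longrightarrow>
        (\<exists>X\<in>UT2Z.
           jordan_product (map_mat rat_of_int (A i)) (map_mat rat_of_int (A j)) + map_mat rat_of_int N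
             = map_mat rat_of_int (X ^\<^sub>m 2)))"

definition UT_jordan_D_quadruple :: "int mat \<Rightarrow> int mat set \<Rightarrow> bool" where
  "UT_jordan_D_quadruple N S \<longleftrightarrow>
     (\<exists>A. jordan_D_property N A \<and> inj_on A {1..4} \<and>
          (\<forall>i\<in>{1..4}. A i \<noteq> 0\<^sub>m 2 2) \<and> S = A ` {1..4})"

lemma upper_triangular_in_UT2Z: "mat_of_rows_list 2 [[a, b], [0, d]] \<in> UT2Z"
  by (auto simp: UT2Z_def mat_of_rows_list_def less_Suc_eq numeral_2_eq_2)

end

theory Submission
  imports Defs
begin

text \<open>
  The obstruction is 2-adic.  On the diagonal, the property says that the diagonal entries
  in each of the two positions form four integers whose pairwise products become squares
  after adding a number congruent to 5 modulo 8.  As squares are 0, 1 or 4 modulo 8, such a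
  product is 3, 4 or 7 modulo 8.  This confines the residues modulo 4: two of the integers are
  either both 2 modulo 4, or they have different residues, neither of which is 2.  Only three
  residues are available in the second case, so four integers must all be 2 modulo 4
  (this is the argument of \<open>residues_of_four_integers\<close>).  Thus all traces are divisible by 4,
  and the diagonal entries of every square root \<open>X\<close> of \<open>A \<circ> B + N\<close> are odd.

  The off-diagonal entry then gives a contradiction.  The entry of \<open>A \<circ> B\<close> there is half
  the sum of two terms, each of which is an off-diagonal entry times a trace, so it is even.
  The entry of \<open>X\<^sup>2\<close> there is a multiple of the trace of \<open>X\<close>, a sum of two odd numbers, so
  it is even too.  But the two differ by \<open>2 * m + 1\<close>.
\<close>

text \<open>
  The off-diagonal equation is doubled to clear the denominator of the Jordan product; its
  parity argument therefore becomes one modulo 4.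
\<close>
lemma upper_triangular_jordan_square_entries:
  fixes A B N X :: "int mat"
  assumes UT: "A \<in> UT2Z" "B \<in> UT2Z" "N \<in> UT2Z" "X \<in> UT2Z"
    and eq: "jordan_product (map_mat rat_of_int A) (map_mat rat_of_int B) + map_mat rat_of_int N
               = map_mat rat_of_int (X ^\<^sub>m 2)"
  shows "A $$ (0,0) * B $$ (0,0) + N $$ (0,0) = (X $$ (0,0))\<^sup>2"
    and "A $$ (1,1) * B $$ (1,1) + N $$ (1,1) = (X $$ (1,1))\<^sup>2"
    and "(A $$ (0,0) + A $$ (1,1)) * B $$ (0,1) + (B $$ (0,0) + B $$ (1,1)) * A $$ (0,1)
           + 2 * N $$ (0,1) = 2 * (X $$ (0,1) * (X $$ (0,0) + X $$ (1,1)))"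
proof -
  have dims: "M \<in> carrier_mat 2 2" "dim_row M = 2" "dim_col M = 2" "M $$ (Suc 0, 0) = 0"
    if "M \<in> UT2Z" for M
    using that by (auto simp: UT2Z_def)
  note d = dims[OF UT(1)] dims[OF UT(2)] dims[OF UT(3)] dims[OF UT(4)]
  have entry: "(jordan_product (map_mat rat_of_int A) (map_mat rat_of_int B)
                 + map_mat rat_of_int N) $$ (i, j) = rat_of_int ((X ^\<^sub>m 2) $$ (i, j))"
    if "i < 2" "j < 2" for i j
    using that d by (simp add: eq numeral_2_eq_2)
  have "rat_of_int (A $$ (0,0) * B $$ (0,0) + N $$ (0,0)) = rat_of_int ((X $$ (0,0))\<^sup>2)"
    using entry[of 0 0] d
    by (simp add: jordan_product_def scalar_prod_def numeral_2_eq_2 algebra_simps)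
  then show "A $$ (0,0) * B $$ (0,0) + N $$ (0,0) = (X $$ (0,0))\<^sup>2"
    by (simp only: of_int_eq_iff)
  have "rat_of_int (A $$ (1,1) * B $$ (1,1) + N $$ (1,1)) = rat_of_int ((X $$ (1,1))\<^sup>2)"
    using entry[of 1 1] d
    by (simp add: jordan_product_def scalar_prod_def numeral_2_eq_2 algebra_simps)
  then show "A $$ (1,1) * B $$ (1,1) + N $$ (1,1) = (X $$ (1,1))\<^sup>2"
    by (simp only: of_int_eq_iff)
  have "rat_of_int ((A $$ (0,0) + A $$ (1,1)) * B $$ (0,1)
           + (B $$ (0,0) + B $$ (1,1)) * A $$ (0,1) + 2 * N $$ (0,1))
       = rat_of_int (2 * (X $$ (0,1) * (X $$ (0,0) + X $$ (1,1))))"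
    using entry[of 0 1] d
    by (simp add: jordan_product_def scalar_prod_def numeral_2_eq_2 field_simps)
  then show "(A $$ (0,0) + A $$ (1,1)) * B $$ (0,1) + (B $$ (0,0) + B $$ (1,1)) * A $$ (0,1)
           + 2 * N $$ (0,1) = 2 * (X $$ (0,1) * (X $$ (0,0) + X $$ (1,1)))"
    by (simp only: of_int_eq_iff)
qed

lemma square_mod_8: "(x::int)\<^sup>2 mod 8 \<in> {0, 1, 4}"
proof -
  have "x mod 8 \<in> {0, 1, 2, 3, 4, 5, 6, 7}" by auto
  moreover have "x\<^sup>2 mod 8 = (x mod 8)\<^sup>2 mod 8" by (simp add: power_mod)
  ultimately show ?thesis by auto
qed

text \<open>
  The product must be 3, 4 or 7 modulo 8.  It can be 3 or 7 only if the factors are 1 and 3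
  modulo 4 in some order, and 4 only if both are 2 modulo 4 or one is odd and the other
  divisible by 4.
\<close>
lemma residues_if_product_plus_5_is_square:
  fixes u v x r :: int
  assumes "u * v + (8 * r + 5) = x\<^sup>2"
  shows "u mod 4 = 2 \<and> v mod 4 = 2 \<or> u mod 4 \<noteq> 2 \<and> v mod 4 \<noteq> 2 \<and> u mod 4 \<noteq> v mod 4"
proof -
  have "(u * v + (8 * r + 5)) mod 8 \<in> {0, 1, 4}"
    unfolding assms by (rule square_mod_8)
  then have uv: "(u * v) mod 8 \<in> {3, 4, 7}" by auto presburger+
  let ?R = "{0, 1, 2, 3, 4, 5, 6, 7} :: int set"
  have table: "\<forall>p\<in>?R. \<forall>q\<in>?R. (p * q) mod 8 \<in> {3, 4, 7} \<longrightarrow>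
      p mod 4 = 2 \<and> q mod 4 = 2 \<or> p mod 4 \<noteq> 2 \<and> q mod 4 \<noteq> 2 \<and> p mod 4 \<noteq> q mod 4"
    by simp
  have range: "w mod 8 \<in> ?R" for w :: int by auto
  have "((u mod 8) * (v mod 8)) mod 8 \<in> {3, 4, 7}"
    using uv by (simp only: mod_mult_eq)
  with table range have "u mod 8 mod 4 = 2 \<and> v mod 8 mod 4 = 2 \<or>
      u mod 8 mod 4 \<noteq> 2 \<and> v mod 8 mod 4 \<noteq> 2 \<and> u mod 8 mod 4 \<noteq> v mod 8 mod 4"
    by blast
  then show ?thesis by (simp add: mod_mod_cancel)
qed

text \<open>
  If one of the integers is not 2 modulo 4, then none is, and their residues are four distinct
  elements of \<open>{0, 1, 3}\<close>.  The conclusion mentions two of the integers because a single pair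
  of matrices already gives the contradiction in the off-diagonal entry.
\<close>
lemma residues_of_four_integers:
  fixes a :: "nat \<Rightarrow> int"
  assumes "\<And>i j. 1 \<le> i \<Longrightarrow> i < j \<Longrightarrow> j \<le> 4 \<Longrightarrow> \<exists>x. a i * a j + (8 * r + 5) = x\<^sup>2"
  shows "a 1 mod 4 = 2 \<and> a 2 mod 4 = 2"
proof -
  have pair: "a i mod 4 = 2 \<and> a j mod 4 = 2
      \<or> a i mod 4 \<noteq> 2 \<and> a j mod 4 \<noteq> 2 \<and> a i mod 4 \<noteq> a j mod 4"
    if "1 \<le> i" "i < j" "j \<le> 4" for i j
    using assms[OF that] residues_if_product_plus_5_is_square by blast
  have "a 1 mod 4 = 2"
  proof (rule ccontr)
    assume a1: "a 1 mod 4 \<noteq> 2"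
    have "a i mod 4 \<noteq> 2" if "i \<in> {1..4}" for i
      using a1 pair[of 1 i] that by (cases "i = 1") auto
    moreover have "w mod 4 \<in> {0, 1, 2, 3}" for w :: int by auto
    ultimately have "(\<lambda>i. a i mod 4) ` {1..4} \<subseteq> {0, 1, 3}" by blast
    moreover have "inj_on (\<lambda>i. a i mod 4) {1..4}"
    proof (rule linorder_inj_onI)
      fix i j :: nat
      assume "i < j" "i \<in> {1..4}" "j \<in> {1..4}"
      then show "a i mod 4 \<noteq> a j mod 4"
        using pair[of i j] pair[of 1 i] a1 by (cases "i = 1") auto
    qed auto
    ultimately have "card {1..4::nat} \<le> card {0, 1, 3 :: int}"
      by (intro card_inj_on_le) auto
    then show False by simp
  qed
  then show ?thesis using pair[of 1 2] by auto
qed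

lemma odd_if_product_plus_odd_is_square:
  fixes u v s x :: int
  assumes "u * v + s = x\<^sup>2" "u mod 4 = 2" "odd s"
  shows "odd x"
proof -
  have "even u" using assms(2) by presburger
  then have "odd (x\<^sup>2)" using assms(3) by (simp flip: assms(1))
  then show ?thesis by simp
qed

lemma no_jordan_D_property:
  "\<not> jordan_D_property (mat_of_rows_list 2 [[8 * k + 5, 2 * m + 1], [0, 8 * n + 5]]) A"
  (is "\<not> jordan_D_property ?N A")
proof
  assume D: "jordan_D_property ?N A"
  have N: "?N \<in> UT2Z" by (rule upper_triangular_in_UT2Z)
  have N_entries: "?N $$ (0,0) = 8 * k + 5" "?N $$ (0,1) = 2 * m + 1" "?N $$ (1,1) = 8 * n + 5"
    by (simp_all add: mat_of_rows_list_def)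
  have UT: "A i \<in> UT2Z" if "1 \<le> i" "i \<le> 4" for i
    using D that by (simp add: jordan_D_property_def)
  have root: "\<exists>X.
      A i $$ (0,0) * A j $$ (0,0) + (8 * k + 5) = (X $$ (0,0))\<^sup>2 \<and>
      A i $$ (1,1) * A j $$ (1,1) + (8 * n + 5) = (X $$ (1,1))\<^sup>2 \<and>
      (A i $$ (0,0) + A i $$ (1,1)) * A j $$ (0,1) + (A j $$ (0,0) + A j $$ (1,1)) * A i $$ (0,1)
        + 2 * (2 * m + 1) = 2 * (X $$ (0,1) * (X $$ (0,0) + X $$ (1,1)))"
    if ij: "1 \<le> i" "i < j" "j \<le> 4" for i j
  proof -
    obtain X where X: "X \<in> UT2Z"
      "jordan_product (map_mat rat_of_int (A i)) (map_mat rat_of_int (A j)) + map_mat rat_of_int ?N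
         = map_mat rat_of_int (X ^\<^sub>m 2)"
      using D ij unfolding jordan_D_property_def by blast
    have "A i \<in> UT2Z" "A j \<in> UT2Z" using UT ij by auto
    from upper_triangular_jordan_square_entries[OF this N X] show ?thesis
      unfolding N_entries by blast
  qed
  have a: "A 1 $$ (0,0) mod 4 = 2 \<and> A 2 $$ (0,0) mod 4 = 2"
    by (rule residues_of_four_integers[of "\<lambda>i. A i $$ (0,0)" k]) (use root in blast)
  have c: "A 1 $$ (1,1) mod 4 = 2 \<and> A 2 $$ (1,1) mod 4 = 2"
    by (rule residues_of_four_integers[of "\<lambda>i. A i $$ (1,1)" n]) (use root in blast)
  obtain X :: "int mat" where
    X0: "A 1 $$ (0,0) * A 2 $$ (0,0) + (8 * k + 5) = (X $$ (0,0))\<^sup>2" and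
    X1: "A 1 $$ (1,1) * A 2 $$ (1,1) + (8 * n + 5) = (X $$ (1,1))\<^sup>2" and
    X01: "(A 1 $$ (0,0) + A 1 $$ (1,1)) * A 2 $$ (0,1)
        + (A 2 $$ (0,0) + A 2 $$ (1,1)) * A 1 $$ (0,1)
        + 2 * (2 * m + 1) = 2 * (X $$ (0,1) * (X $$ (0,0) + X $$ (1,1)))"
    using root[of 1 2] by auto
  have "odd (X $$ (0,0))" "odd (X $$ (1,1))"
    using odd_if_product_plus_odd_is_square[OF X0] odd_if_product_plus_odd_is_square[OF X1] a c
    by auto
  then have right: "4 dvd 2 * (X $$ (0,1) * (X $$ (0,0) + X $$ (1,1)))"
    using mult_dvd_mono[of 2 2 2 "X $$ (0,1) * (X $$ (0,0) + X $$ (1,1))"] by simp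
  have "4 dvd A 1 $$ (0,0) + A 1 $$ (1,1)" "4 dvd A 2 $$ (0,0) + A 2 $$ (1,1)"
    using a c by presburger+
  then have "4 dvd (A 1 $$ (0,0) + A 1 $$ (1,1)) * A 2 $$ (0,1)
        + (A 2 $$ (0,0) + A 2 $$ (1,1)) * A 1 $$ (0,1)"
    by (rule dvd_add[OF dvd_mult2 dvd_mult2])
  with right have "4 dvd 2 * (2 * m + 1)"
    unfolding X01[symmetric] by (simp only: dvd_add_right_iff)
  then show False by presburger
qed

theorem proposition13:
  fixes k m n :: int and N :: "int mat"
  assumes "N = mat_of_rows_list 2 [[8 * k + 5, 2 * m + 1], [0, 8 * n + 5]]"
  shows "(\<nexists>A. jordan_D_property N A) \<and> (\<nexists>S. UT_jordan_D_quadruple N S)"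
  using no_jordan_D_property assms by (auto simp: UT_jordan_D_quadruple_def)

end
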